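(* Let $(X_n)_{n\in\mathbb{N}}$ be an $\mathcal{SL}$-supermartingale with $\sup_k\mathcal{E}(X_k^-)<\infty$. Then the sequence $X_n$ converges quasi-surely to a random variable $X_\infty\in\mathcal{H}^{\mathrm{ext}}$ with $\mathcal{E}^{\mathrm{ext}}(|X_\infty|)<\infty$.
   Context: Let $(\Omega,\mathcal{F})$ be a measurable space with a discrete-time filtration $\{\mathcal{F}_t\}_{t\in\mathbb{N}}$, $\mathbb{N}=\{0,1,2,\dots\}$, such that $\mathcal{F}=\mathcal{F}_\infty=\sigma(\bigcup_t\mathcal{F}_t)$ and $\mathcal{F}_0$ is trivial. $m\mathcal{F}$, $m\mathcal{F}_t$ denote the $\mathcal{F}$-, $\mathcal{F}_t$-measurable $\mathbb{R}\cup\{\pm\infty\}$-valued functions. $\mathcal{H}$ is a linear space of $\mathcal{F}$-measurable $\mathbb{R}$-valued functions on $\Omega$ containing the constants, such that $X\in\mathcal{H}$ implies $|X|\in\mathcal{H}$ and $I_AX\in\mathcal{H}$ for all $A\in\mathcal{F}$; $\mathcal{H}_t:=\mathcal{H}\cap m\mathcal{F}_t$. $\mathcal{E}$ is an $\mathcal{SL}$-expectation: a family of maps $\mathcal{E}_t:\mathcal{H}\to\mathcal{H}_t$ such that for all $X,Y\in\mathcal{H}$, $s\le t$: (i) $X\ge Y$ implies $\mathcal{E}_t(X)\ge\mathcal{E}_t(Y)$; (ii) $\mathcal{E}_s(Y)=\mathcal{E}_s(\mathcal{E}_t(Y))$; (iii) $\mathcal{E}_t(I_AY)=I_A\mathcal{E}_t(Y)$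 for $A\in\mathcal{F}_t$; (iv) $\mathcal{E}_t(Y)=Y$ for $Y\in\mathcal{H}_t$; (v) $\mathcal{E}_t(X+Y)\le\mathcal{E}_t(X)+\mathcal{E}_t(Y)$; (vi) $\mathcal{E}_t(\lambda Y)=\lambda^+\mathcal{E}_t(Y)+\lambda^-\mathcal{E}_t(-Y)$ for $\lambda\in\mathcal{H}_t$ with $\lambda Y\in\mathcal{H}$; (vii) if $X_i\in\mathcal{H}$ and $X_i(\omega)\downarrow0$ for every $\omega$, then $\mathcal{E}_0(X_i)\to0$. Write $\mathcal{E}=\mathcal{E}_0$ (real-valued). Such $\mathcal{E}$ has a representation $\mathcal{E}(Y)=\sup_{\theta\in\Theta}E_\theta[Y]$ for a collection $\Theta$ of ($\sigma$-additive) probability measures, which is fixed. A statement holds quasi-surely (q.s.) if it holds outside a set $N$ with $\mathcal{E}(I_N)=0$. Define $\mathcal{H}^{\mathrm{ext}}=\{X\in m\mathcal{F}:\min\{E_\theta[X^+],E_\theta[X^-]\}<\infty\ \forall\theta\in\Theta\}$ and $\mathcal{E}^{\mathrm{ext}}(X)=\sup_{\theta\in\Theta}E_\theta[X]$. $L^1$ is the completion of $\{X\in\mathcal{H}:\mathcal{E}(|X|)<\infty\}$ under $\|X\|_1=\mathcal{E}(|X|)$, modulo equality in $\|\cdot\|_1$; its elements are regarded as elements of $\mathcal{H}^{\mathrm{ext}}$ (up to q.s. equality), and each $\mathcal{E}_t$ extends to $L^1$ by $\mathcal{E}_t(X)=\lim\mathcal{E}_t(X_n)$ (limit in $L^1$)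 for $X_n\to X$ in $L^1$. An $\mathcal{SL}$-supermartingale is a process $X$ with $X_t\in L^1\cap m\mathcal{F}_t$ for all $t$ and $X_s\ge\mathcal{E}_s(X_t)$ for all $s\le t$ (relations in $L^1$ are understood q.s.). $x^-=\max(-x,0)$. *)

theory Defs
  imports "HOL-Probability.Probability"
begin

text \<open>
  The measurable space is \<open>(space M, sets M)\<close>; the measure carried by \<open>M\<close> is never used.
  Random variables are total functions whose values outside \<open>space M\<close> are irrelevant.
  The map \<open>\<E>\<^sub>t\<close> is \<open>E t\<close>, and only its values on \<open>H\<close> matter.
\<close>

text \<open>
  \<open>\<F>\<^sub>0\<close> is trivial, so \<open>E 0 Y\<close> is constant on \<open>space M\<close>; this constant is the real number \<open>\<E>(Y)\<close>.
\<close>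

definition SL_mean :: "'a measure \<Rightarrow> (nat \<Rightarrow> ('a \<Rightarrow> real) \<Rightarrow> 'a \<Rightarrow> real) \<Rightarrow> ('a \<Rightarrow> real) \<Rightarrow> real" where
  "SL_mean M E Y = (THE c. \<forall>\<omega>\<in>space M. E 0 Y \<omega> = c)"

locale SL_expectation = filtration "space M" F
  for M :: "'a measure" and F :: "nat \<Rightarrow> 'a measure" +
  fixes H :: "('a \<Rightarrow> real) set" and E :: "nat \<Rightarrow> ('a \<Rightarrow> real) \<Rightarrow> 'a \<Rightarrow> real"
  assumes sets_M: "sets M = sigma_sets (space M) (\<Union>t. sets (F t))"
    and trivial_F0: "sets (F 0) = {{}, space M}"
    and H_measurable: "H \<subseteq> borel_measurable M"
    and H_const: "\<And>c. (\<lambda>_. c) \<in> H"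
    and H_add: "\<And>X Y. X \<in> H \<Longrightarrow> Y \<in> H \<Longrightarrow> (\<lambda>\<omega>. X \<omega> + Y \<omega>) \<in> H"
    and H_scale: "\<And>c X. X \<in> H \<Longrightarrow> (\<lambda>\<omega>. c * X \<omega>) \<in> H"
    and H_abs: "\<And>X. X \<in> H \<Longrightarrow> (\<lambda>\<omega>. \<bar>X \<omega>\<bar>) \<in> H"
    and H_indicator: "\<And>A X. A \<in> sets M \<Longrightarrow> X \<in> H \<Longrightarrow> (\<lambda>\<omega>. indicat_real A \<omega> * X \<omega>) \<in> H"
    and E_range: "\<And>t X. X \<in> H \<Longrightarrow> E t X \<in> H \<inter> borel_measurable (F t)"
    and E_mono: "\<And>t X Y. X \<in> H \<Longrightarrow> Y \<in> H \<Longrightarrow> \<forall>\<omega>\<in>space M. Y \<omega> \<le> X \<omega> \<Longrightarrow>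
          \<forall>\<omega>\<in>space M. E t Y \<omega> \<le> E t X \<omega>"
    and E_tower: "\<And>s t Y. s \<le> t \<Longrightarrow> Y \<in> H \<Longrightarrow> \<forall>\<omega>\<in>space M. E s Y \<omega> = E s (E t Y) \<omega>"
    and E_indicator: "\<And>t A Y. A \<in> sets (F t) \<Longrightarrow> Y \<in> H \<Longrightarrow>
          \<forall>\<omega>\<in>space M. E t (\<lambda>\<omega>. indicat_real A \<omega> * Y \<omega>) \<omega> = indicat_real A \<omega> * E t Y \<omega>"
    and E_adapted: "\<And>t Y. Y \<in> H \<Longrightarrow> Y \<in> borel_measurable (F t) \<Longrightarrow> \<forall>\<omega>\<in>space M. E t Y \<omega> = Y \<omega>"
    and E_subadd: "\<And>t X Y. X \<in> H \<Longrightarrow> Y \<in> H \<Longrightarrow>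
          \<forall>\<omega>\<in>space M. E t (\<lambda>\<omega>. X \<omega> + Y \<omega>) \<omega> \<le> E t X \<omega> + E t Y \<omega>"
    and E_scale: "\<And>t l Y. l \<in> H \<Longrightarrow> l \<in> borel_measurable (F t) \<Longrightarrow> Y \<in> H \<Longrightarrow> (\<lambda>\<omega>. l \<omega> * Y \<omega>) \<in> H \<Longrightarrow>
          \<forall>\<omega>\<in>space M. E t (\<lambda>\<omega>. l \<omega> * Y \<omega>) \<omega>
            = max (l \<omega>) 0 * E t Y \<omega> + max (- l \<omega>) 0 * E t (\<lambda>\<omega>. - Y \<omega>) \<omega>"
    and E_cont: "\<And>X. (\<And>i. X i \<in> H) \<Longrightarrow>
          \<forall>\<omega>\<in>space M. decseq (\<lambda>i. X i \<omega>) \<and> (\<lambda>i. X i \<omega>) \<longlonglongrightarrow> 0 \<Longrightarrow>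
          (\<lambda>i. SL_mean M E (X i)) \<longlonglongrightarrow> 0"

definition quasi_surely ::
  "'a measure \<Rightarrow> (nat \<Rightarrow> ('a \<Rightarrow> real) \<Rightarrow> 'a \<Rightarrow> real) \<Rightarrow> ('a \<Rightarrow> bool) \<Rightarrow> bool" where
  "quasi_surely M E Q \<longleftrightarrow>
    (\<exists>N\<in>sets M. SL_mean M E (indicat_real N) = 0 \<and> (\<forall>\<omega>\<in>space M - N. Q \<omega>))"

text \<open>
  Since \<open>e2ennreal\<close> sends negative values to \<open>0\<close>, the two integrals below are those of
  \<open>X\<^sup>+\<close> and \<open>X\<^sup>-\<close>.
\<close>

definition ext_expectation :: "'a measure \<Rightarrow> ('a \<Rightarrow> ereal) \<Rightarrow> ereal" where
  "ext_expectation P X =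
    enn2ereal (\<integral>\<^sup>+\<omega>. e2ennreal (X \<omega>) \<partial>P) - enn2ereal (\<integral>\<^sup>+\<omega>. e2ennreal (- X \<omega>) \<partial>P)"

definition H_ext :: "'a measure \<Rightarrow> 'a measure set \<Rightarrow> ('a \<Rightarrow> ereal) set" where
  "H_ext M \<Theta> = {X \<in> borel_measurable M.
    \<forall>P\<in>\<Theta>. min (\<integral>\<^sup>+\<omega>. e2ennreal (X \<omega>) \<partial>P) (\<integral>\<^sup>+\<omega>. e2ennreal (- X \<omega>) \<partial>P) < \<infinity>}"

definition E_ext :: "'a measure set \<Rightarrow> ('a \<Rightarrow> ereal) \<Rightarrow> ereal" where
  "E_ext \<Theta> X = (SUP P\<in>\<Theta>. ext_expectation P X)"

text \<open>
  Finiteness of \<open>\<E>\<close> on \<open>H\<close>, applied to \<open>\<bar>Y\<bar>\<close>, forces every \<open>Y \<in> H\<close> to be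
  integrable under every \<open>P \<in> \<Theta>\<close>.
\<close>

definition SL_representation ::
  "'a measure \<Rightarrow> ('a \<Rightarrow> real) set \<Rightarrow> (nat \<Rightarrow> ('a \<Rightarrow> real) \<Rightarrow> 'a \<Rightarrow> real) \<Rightarrow> 'a measure set \<Rightarrow> bool" where
  "SL_representation M H E \<Theta> \<longleftrightarrow>
    (\<forall>P\<in>\<Theta>. prob_space P \<and> sets P = sets M) \<and>
    (\<forall>Y\<in>H. ereal (SL_mean M E Y) = E_ext \<Theta> (\<lambda>\<omega>. ereal (Y \<omega>)))"

text \<open>
  Elements of the completion of \<open>H\<close> are given by Cauchy sequences for \<open>\<parallel>X\<parallel>\<^sub>1 = \<E>(\<bar>X\<bar>)\<close>
  (finite on all of \<open>H\<close>). Such an element is regarded as the function \<open>X \<in> \<H>\<^sup>e\<^sup>x\<^sup>t\<close>, unique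
  up to quasi-sure equality, to which the sequence converges in \<open>\<E>\<^sup>e\<^sup>x\<^sup>t(\<bar>\<cdot>\<bar>)\<close>.
\<close>

definition L1_Cauchy ::
  "'a measure \<Rightarrow> ('a \<Rightarrow> real) set \<Rightarrow> (nat \<Rightarrow> ('a \<Rightarrow> real) \<Rightarrow> 'a \<Rightarrow> real) \<Rightarrow> (nat \<Rightarrow> 'a \<Rightarrow> real) \<Rightarrow> bool" where
  "L1_Cauchy M H E Xs \<longleftrightarrow> (\<forall>n. Xs n \<in> H) \<and>
    (\<forall>e>0. \<exists>n0. \<forall>m\<ge>n0. \<forall>n\<ge>n0. SL_mean M E (\<lambda>\<omega>. \<bar>Xs m \<omega> - Xs n \<omega>\<bar>) < e)"

definition L1_tendsto :: "'a measure set \<Rightarrow> (nat \<Rightarrow> 'a \<Rightarrow> real) \<Rightarrow> ('a \<Rightarrow> ereal) \<Rightarrow> bool" where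
  "L1_tendsto \<Theta> Xs X \<longleftrightarrow> (\<lambda>n. E_ext \<Theta> (\<lambda>\<omega>. \<bar>ereal (Xs n \<omega>) - X \<omega>\<bar>)) \<longlonglongrightarrow> 0"

definition SL_L1 ::
  "'a measure \<Rightarrow> ('a \<Rightarrow> real) set \<Rightarrow> (nat \<Rightarrow> ('a \<Rightarrow> real) \<Rightarrow> 'a \<Rightarrow> real) \<Rightarrow> 'a measure set \<Rightarrow> ('a \<Rightarrow> ereal) set" where
  "SL_L1 M H E \<Theta> = {X \<in> H_ext M \<Theta>. \<exists>Xs. L1_Cauchy M H E Xs \<and> L1_tendsto \<Theta> Xs X}"

text \<open>
  For \<open>X\<close> in \<open>L\<^sup>1\<close>, the function \<open>Z\<close> is a version of the extended \<open>\<E>\<^sub>t(X)\<close>; such \<open>Z\<close> is unique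
  up to quasi-sure equality and does not depend on the approximating sequence.
\<close>

definition L1_version ::
  "'a measure \<Rightarrow> ('a \<Rightarrow> real) set \<Rightarrow> (nat \<Rightarrow> ('a \<Rightarrow> real) \<Rightarrow> 'a \<Rightarrow> real) \<Rightarrow> 'a measure set \<Rightarrow>
    nat \<Rightarrow> ('a \<Rightarrow> ereal) \<Rightarrow> ('a \<Rightarrow> ereal) \<Rightarrow> bool" where
  "L1_version M H E \<Theta> t X Z \<longleftrightarrow> Z \<in> SL_L1 M H E \<Theta> \<and>
    (\<exists>Xs. (\<forall>n. Xs n \<in> H) \<and> L1_tendsto \<Theta> Xs X \<and> L1_tendsto \<Theta> (\<lambda>n. E t (Xs n)) Z)"

definition L1_mean ::
  "'a measure \<Rightarrow> ('a \<Rightarrow> real) set \<Rightarrow> (nat \<Rightarrow> ('a \<Rightarrow> real) \<Rightarrow> 'a \<Rightarrow> real) \<Rightarrow> 'a measure set \<Rightarrow>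
    ('a \<Rightarrow> ereal) \<Rightarrow> real" where
  "L1_mean M H E \<Theta> X = (THE c. L1_version M H E \<Theta> 0 X (\<lambda>_. ereal c))"

definition SL_supermartingale ::
  "'a measure \<Rightarrow> (nat \<Rightarrow> 'a measure) \<Rightarrow> ('a \<Rightarrow> real) set \<Rightarrow> (nat \<Rightarrow> ('a \<Rightarrow> real) \<Rightarrow> 'a \<Rightarrow> real) \<Rightarrow>
    'a measure set \<Rightarrow> (nat \<Rightarrow> 'a \<Rightarrow> ereal) \<Rightarrow> bool" where
  "SL_supermartingale M F H E \<Theta> X \<longleftrightarrow>
    (\<forall>t. X t \<in> SL_L1 M H E \<Theta> \<inter> borel_measurable (F t)) \<and>
    (\<forall>s t. s \<le> t \<longrightarrow>
      (\<exists>Z. L1_version M H E \<Theta> s (X t) Z \<and> quasi_surely M E (\<lambda>\<omega>. Z \<omega> \<le> X s \<omega>)))"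

end

theory Submission
  imports Defs
begin

text \<open>
  Every representing measure \<open>P \<in> \<Theta>\<close> turns \<open>X\<close> into a classical \<open>P\<close>-supermartingale: since
  \<open>\<E>\<^sub>s(Y - \<E>\<^sub>s(Y)) \<le> 0\<close>, time consistency gives \<open>E\<^sub>P[I\<^sub>A Y] \<le> E\<^sub>P[I\<^sub>A \<E>\<^sub>s(Y)]\<close> for \<open>A \<in> \<F>\<^sub>s\<close>, and this
  survives limits in \<open>L\<^sup>1\<close>. On \<open>L\<^sup>1\<close> the extended \<open>\<E>\<close> is still the supremum of the \<open>E\<^sub>P\<close>, so the negative
  parts are bounded in mean uniformly in \<open>P\<close>. Doob's upcrossing inequality makes \<open>X\<close> converge
  \<open>P\<close>-almost surely for each \<open>P\<close>, hence quasi-surely to its upper limit, because a set is polar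
  exactly when it is null for all \<open>P\<close>. Fatou's lemma bounds the limit.
\<close>

section \<open>Upcrossings and supermartingale convergence\<close>

text \<open>
  The strategy buys when the sequence falls below \<open>a\<close> and sells when it next exceeds \<open>b\<close>;
  \<open>holding a b x n\<close> is the position over the step from \<open>n\<close> to \<open>n + 1\<close>.
\<close>

fun holding :: "real \<Rightarrow> real \<Rightarrow> (nat \<Rightarrow> real) \<Rightarrow> nat \<Rightarrow> bool" where
  "holding a b x 0 \<longleftrightarrow> x 0 < a"
| "holding a b x (Suc n) \<longleftrightarrow> (if holding a b x n then x (Suc n) \<le> b else x (Suc n) < a)"

text \<open>Every sale of the strategy completes one upcrossing of the interval from
  \<open>a\<close> to \<open>b\<close>, so counting sales replaces the usual stopping times by a
  recursion in step with \<open>holding\<close>.\<close>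

fun upcrossings :: "real \<Rightarrow> real \<Rightarrow> (nat \<Rightarrow> real) \<Rightarrow> nat \<Rightarrow> nat" where
  "upcrossings a b x 0 = 0"
| "upcrossings a b x (Suc n) =
    upcrossings a b x n + (if holding a b x n \<and> b < x (Suc n) then 1 else 0)"

lemma upcrossings_mono: "m \<le> n \<Longrightarrow> upcrossings a b x m \<le> upcrossings a b x n"
  by (rule lift_Suc_mono_le) auto

text \<open>Each completed round trip earns at least \<open>b - a\<close>, and the position that may
  still be open at time \<open>n\<close> loses at most \<open>max (a - x n) 0\<close>. The sum on
  the right is the total gain from trading.\<close>

lemma upcrossings_gain:
  assumes "a < b"
  shows "(b - a) * upcrossings a b x n - max (a - x n) 0
    \<le> (\<Sum>k<n. of_bool (holding a b x k) * (x (Suc k) - x k))"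
proof -
  \<comment> \<open>an open position was bought below \<open>a\<close>, so it has gained at least \<open>x n - a\<close>\<close>
  have "(b - a) * upcrossings a b x n + (if holding a b x n then x n - a else 0)
    \<le> (\<Sum>k<n. of_bool (holding a b x k) * (x (Suc k) - x k))"
  proof (induction n)
    case (Suc n)
    then show ?case
      using assms by (auto simp: algebra_simps split: if_splits)
  qed auto
  then show ?thesis
    by (auto simp: max_def split: if_splits)
qed

text \<open>The count is nondecreasing and bounded, hence constant from some time on, and no sale
  takes place after that time. A position open then would be sold when the path next exceeds
  \<open>b\<close>; without one, a position would be opened when the path next falls below
  \<open>a\<close>.\<close>

lemma bounded_upcrossings_contradiction:
  assumes bdd: "\<And>n. upcrossings a b x n \<le> k"
    and low: "\<exists>\<^sub>F n in sequentially. x n < a" and high: "\<exists>\<^sub>F n in sequentially. b < x n"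
  shows False
proof -
  define m where "m = Max (range (upcrossings a b x))"
  have fin: "finite (range (upcrossings a b x))"
    by (rule finite_subset[of _ "{..k}"]) (use bdd in auto)
  have "m \<in> range (upcrossings a b x)"
    unfolding m_def using fin by (intro Max_in) auto
  then obtain n0 where n0: "upcrossings a b x n0 = m"
    by auto
  have const: "upcrossings a b x n = m" if "n0 \<le> n" for n
    using upcrossings_mono[OF that, of a b x] Max_ge[OF fin, of "upcrossings a b x n"] n0
    by (auto simp: m_def)
  have stay: "holding a b x (n + j)" if "n0 \<le> n" "holding a b x n" for n j
  proof (induction j)
    case (Suc j)
    have "upcrossings a b x (Suc (n + j)) = upcrossings a b x (n + j)"
      using const[of "n + j"] const[of "Suc (n + j)"] that(1) by (simp del: upcrossings.simps)
    then show ?case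
      using Suc by (auto split: if_splits)
  qed (use that in simp)
  have not_holding: "\<not> holding a b x n" if n: "n0 \<le> n" for n
  proof
    assume h: "holding a b x n"
    obtain m' where m': "Suc n \<le> m'" "b < x m'"
      using high by (auto simp: frequently_sequentially)
    then obtain j where j: "m' = Suc (n + j)"
      using le_Suc_ex by force
    have "upcrossings a b x (Suc (n + j)) = upcrossings a b x (n + j)"
      using const[of "n + j"] const[of "Suc (n + j)"] n by (simp del: upcrossings.simps)
    then show False
      using stay[OF n h, of j] m' j by auto
  qed
  \<comment> \<open>Asking for \<open>Suc n0\<close> leaves a predecessor \<open>n - 1\<close> that
    is not before \<open>n0\<close>. No position is held there, so the fall below \<open>a\<close>
    at time \<open>n\<close> opens one.\<close>
  obtain n where "Suc n0 \<le> n" "x n < a"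
    using low by (auto simp: frequently_sequentially)
  then show False
    using not_holding[of n] not_holding[of "n - 1"] by (cases n) auto
qed

text \<open>Rational levels are chosen so that only countably many pairs, and thus countably many
  null sets, have to be considered later.\<close>

lemma liminf_less_limsup_crosses:
  fixes x :: "nat \<Rightarrow> real"
  assumes "liminf (\<lambda>n. ereal (x n)) < limsup (\<lambda>n. ereal (x n))"
  obtains a b :: rat where "a < b" "\<exists>\<^sub>F n in sequentially. x n < of_rat a"
    "\<exists>\<^sub>F n in sequentially. of_rat b < x n"
proof -
  obtain b where b: "liminf (\<lambda>n. ereal (x n)) < ereal (of_rat b)"
      "ereal (of_rat b) < limsup (\<lambda>n. ereal (x n))"
    using ereal_dense3[OF assms] by auto
  obtain a where a: "liminf (\<lambda>n. ereal (x n)) < ereal (of_rat a)"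
      "ereal (of_rat a) < ereal (of_rat b)"
    using ereal_dense3[OF b(1)] by auto
  have "\<exists>\<^sub>F n in sequentially. x n < of_rat a"
  proof (rule ccontr)
    assume "\<not> ?thesis"
    then have "\<forall>\<^sub>F n in sequentially. ereal (of_rat a) \<le> ereal (x n)"
      by (simp add: not_frequently not_less)
    from Liminf_bounded[OF this] a(1) show False
      by (meson leD)
  qed
  moreover have "\<exists>\<^sub>F n in sequentially. of_rat b < x n"
  proof (rule ccontr)
    assume "\<not> ?thesis"
    then have "\<forall>\<^sub>F n in sequentially. ereal (x n) \<le> ereal (of_rat b)"
      by (simp add: not_frequently not_less)
    from Limsup_bounded[OF this] b(2) show False
      by (meson leD)
  qed
  moreover have "a < b"
    using a(2) by (simp add: of_rat_less)
  ultimately show thesis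
    using that by blast
qed

section \<open>Doob's upcrossing inequality and almost sure convergence under one probability
  measure\<close>

context prob_space
begin

text \<open>The supermartingale property is expressed by integrals over events of \<open>F t\<close>
  at consecutive times. In this form it can be read off from \<open>E\<close> for a representing
  measure, without conditional expectations.\<close>

context
  fixes F :: "nat \<Rightarrow> 'a measure" and x :: "nat \<Rightarrow> 'a \<Rightarrow> real"
  assumes filt: "filtration (space M) F"
    and sub: "\<And>t. sets (F t) \<subseteq> sets M"
    and adapted: "\<And>t. x t \<in> borel_measurable (F t)"
    and integrable: "\<And>t. integrable M (x t)"
    and super: "\<And>t A. A \<in> sets (F t) \<Longrightarrow>
      (\<integral>\<omega>. indicator A \<omega> * x (Suc t) \<omega> \<partial>M) \<le> (\<integral>\<omega>. indicator A \<omega> * x t \<omega> \<partial>M)"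
begin

text \<open>The strategy is predictable: the position over the step from \<open>n\<close> to
  \<open>n + 1\<close> is decided by the path up to time \<open>n\<close>. This makes
  \<open>super\<close> applicable to each single step of trading.\<close>

lemma holding_sets: "{\<omega>\<in>space M. holding a b (\<lambda>t. x t \<omega>) n} \<in> sets (F n)"
proof -
  have sp: "space (F n) = space M" for n
    using filt by (rule filtration.space_F)
  note [measurable] = adapted
  show ?thesis
  proof (induction n)
    case 0
    have "{\<omega>\<in>space (F 0). x 0 \<omega> < a} \<in> sets (F 0)"
      by measurable
    then show ?case
      by (simp add: sp)
  next
    case (Suc n)
    then have "{\<omega>\<in>space M. holding a b (\<lambda>t. x t \<omega>) n} \<in> sets (F (Suc n))"
      using filtration.sets_F_mono[OF filt, of n "Suc n"] by auto
    moreover have "{\<omega>\<in>space (F (Suc n)). x (Suc n) \<omega> \<le> b} \<in> sets (F (Suc n))"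
      "{\<omega>\<in>space (F (Suc n)). x (Suc n) \<omega> < a} \<in> sets (F (Suc n))"
      by measurable
    ultimately have "({\<omega>\<in>space M. holding a b (\<lambda>t. x t \<omega>) n} \<inter> {\<omega>\<in>space (F (Suc n)). x (Suc n) \<omega> \<le> b})
      \<union> ({\<omega>\<in>space (F (Suc n)). x (Suc n) \<omega> < a} - {\<omega>\<in>space M. holding a b (\<lambda>t. x t \<omega>) n})
      \<in> sets (F (Suc n))" (is "?A \<in> _")
      by auto
    also have "?A = {\<omega>\<in>space M. holding a b (\<lambda>t. x t \<omega>) (Suc n)}"
      by (auto simp: sp)
    finally show ?case .
  qed
qed

lemma random_variable_upcrossings:
  "(\<lambda>\<omega>. upcrossings a b (\<lambda>t. x t \<omega>) n) \<in> measurable M (count_space UNIV)"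
proof (induction n)
  case (Suc n)
  have [measurable]: "{\<omega>\<in>space M. holding a b (\<lambda>t. x t \<omega>) n} \<in> sets M"
    using holding_sets sub by blast
  have [measurable]: "x (Suc n) \<in> borel_measurable M"
    using integrable by auto
  note Suc[measurable]
  show ?case
    unfolding upcrossings.simps by measurable
qed simp

text \<open>Integrating the pathwise gain leaves one term per step, the expected increment of
  \<open>x\<close> on the event of holding, and \<open>super\<close> makes it nonpositive.
  Integrability holds because at most one sale occurs per step.\<close>

lemma upcrossing_inequality:
  assumes "a < b"
  shows "(b - a) * (\<integral>\<omega>. upcrossings a b (\<lambda>t. x t \<omega>) n \<partial>M) \<le> (\<integral>\<omega>. max (a - x n \<omega>) 0 \<partial>M)"
    and "integrable M (\<lambda>\<omega>. real (upcrossings a b (\<lambda>t. x t \<omega>) n))"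
proof -
  have le: "upcrossings a b y n \<le> n" for y
    by (induction n) auto
  note [measurable] = random_variable_upcrossings
  show int: "integrable M (\<lambda>\<omega>. real (upcrossings a b (\<lambda>t. x t \<omega>) n))"
    by (rule integrable_const_bound[of _ n]) (use le in auto)
  have int': "integrable M (\<lambda>\<omega>. max (a - x n \<omega>) 0)"
    using integrable by auto
  let ?A = "\<lambda>k. {\<omega>\<in>space M. holding a b (\<lambda>t. x t \<omega>) k}"
  have A: "?A k \<in> sets M" for k
    using holding_sets sub by blast
  have intA: "integrable M (\<lambda>\<omega>. indicator (?A k) \<omega> * x j \<omega>)" for j k
    using A integrable by (intro integrable_mult_indicator[where 'b=real, simplified]) auto
  have "(b - a) * (\<integral>\<omega>. upcrossings a b (\<lambda>t. x t \<omega>) n \<partial>M) - (\<integral>\<omega>. max (a - x n \<omega>) 0 \<partial>M)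
    = (\<integral>\<omega>. (b - a) * upcrossings a b (\<lambda>t. x t \<omega>) n - max (a - x n \<omega>) 0 \<partial>M)"
    using int int' by simp
  also have "\<dots> \<le> (\<integral>\<omega>. (\<Sum>k<n. indicator (?A k) \<omega> * x (Suc k) \<omega> - indicator (?A k) \<omega> * x k \<omega>) \<partial>M)"
  proof (rule integral_mono)
    fix \<omega> assume "\<omega> \<in> space M"
    then show "(b - a) * upcrossings a b (\<lambda>t. x t \<omega>) n - max (a - x n \<omega>) 0
      \<le> (\<Sum>k<n. indicator (?A k) \<omega> * x (Suc k) \<omega> - indicator (?A k) \<omega> * x k \<omega>)"
      using upcrossings_gain[OF assms, of "\<lambda>t. x t \<omega>" n]
      by (simp add: indicator_def right_diff_distrib)
  qed (use int int' intA in auto)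
  also have "\<dots> = (\<Sum>k<n. (\<integral>\<omega>. indicator (?A k) \<omega> * x (Suc k) \<omega> \<partial>M)
      - (\<integral>\<omega>. indicator (?A k) \<omega> * x k \<omega> \<partial>M))"
    using intA by simp
  also have "\<dots> \<le> 0"
    using super[OF holding_sets] by (intro sum_nonpos) simp
  finally show "(b - a) * (\<integral>\<omega>. upcrossings a b (\<lambda>t. x t \<omega>) n \<partial>M) \<le> (\<integral>\<omega>. max (a - x n \<omega>) 0 \<partial>M)"
    by simp
qed

text \<open>The expected counts stay below a bound independent of \<open>n\<close>, so by monotone
  convergence their supremum is integrable and hence finite almost everywhere.\<close>

lemma AE_bounded_upcrossings:
  assumes "a < b" and bdd: "\<And>n. (\<integral>\<omega>. max (- x n \<omega>) 0 \<partial>M) \<le> C"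
  shows "AE \<omega> in M. \<exists>k. \<forall>n. upcrossings a b (\<lambda>t. x t \<omega>) n \<le> k"
proof -
  let ?U = "\<lambda>n \<omega>. ennreal (real (upcrossings a b (\<lambda>t. x t \<omega>) n))"
  note [measurable] = random_variable_upcrossings
  have meas: "?U n \<in> borel_measurable M" for n
    by measurable
  have "(\<integral>\<^sup>+\<omega>. ?U n \<omega> \<partial>M) \<le> ennreal ((\<bar>a\<bar> + C) / (b - a))" for n
  proof -
    have "(b - a) * (\<integral>\<omega>. upcrossings a b (\<lambda>t. x t \<omega>) n \<partial>M) \<le> (\<integral>\<omega>. max (a - x n \<omega>) 0 \<partial>M)"
      by (rule upcrossing_inequality) fact
    also have "\<dots> \<le> (\<integral>\<omega>. \<bar>a\<bar> + max (- x n \<omega>) 0 \<partial>M)"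
      using integrable by (intro integral_mono) auto
    also have "\<dots> = \<bar>a\<bar> + (\<integral>\<omega>. max (- x n \<omega>) 0 \<partial>M)"
      using integrable by (simp add: prob_space)
    finally have "(b - a) * (\<integral>\<omega>. upcrossings a b (\<lambda>t. x t \<omega>) n \<partial>M) \<le> \<bar>a\<bar> + C"
      using bdd[of n] by simp
    then have "(\<integral>\<omega>. upcrossings a b (\<lambda>t. x t \<omega>) n \<partial>M) \<le> (\<bar>a\<bar> + C) / (b - a)"
      using assms(1) by (simp add: field_simps)
    then show ?thesis
      using upcrossing_inequality(2)[OF assms(1)]
      by (subst nn_integral_eq_integral) (auto intro: ennreal_leI)
  qed
  then have "(SUP n. \<integral>\<^sup>+\<omega>. ?U n \<omega> \<partial>M) \<le> ennreal ((\<bar>a\<bar> + C) / (b - a))"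
    by (intro SUP_least)
  moreover have "(\<integral>\<^sup>+\<omega>. (SUP n. ?U n \<omega>) \<partial>M) = (SUP n. \<integral>\<^sup>+\<omega>. ?U n \<omega> \<partial>M)"
    by (intro nn_integral_monotone_convergence_SUP meas)
      (auto simp: incseq_def le_fun_def intro!: ennreal_leI upcrossings_mono)
  ultimately have "(\<integral>\<^sup>+\<omega>. (SUP n. ?U n \<omega>) \<partial>M) \<noteq> \<infinity>"
    by (metis ennreal_neq_top infinity_ennreal_def neq_top_trans)
  then have "AE \<omega> in M. (SUP n. ?U n \<omega>) \<noteq> \<infinity>"
    using meas by (intro nn_integral_noteq_infinite) auto
  then show ?thesis
  proof eventually_elim
    case (elim \<omega>)
    then obtain r where r: "(SUP n. ?U n \<omega>) = ennreal r" "0 \<le> r"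
      by (cases "SUP n. ?U n \<omega>") auto
    have "upcrossings a b (\<lambda>t. x t \<omega>) n \<le> nat \<lceil>r\<rceil>" for n
    proof -
      have "?U n \<omega> \<le> ennreal r"
        unfolding r(1)[symmetric] by (rule SUP_upper) simp
      then have "real (upcrossings a b (\<lambda>t. x t \<omega>) n) \<le> r"
        using r(2) by simp
      then show ?thesis
        by linarith
    qed
    then show ?case
      by blast
  qed
qed

text \<open>Oscillation would force unboundedly many upcrossings of some rational interval, which
  almost surely happens for none of the countably many. The limit is taken in the extended reals;
  its integrability is left to Fatou's lemma.\<close>

theorem supermartingale_AE_convergent:
  assumes bdd: "\<And>n. (\<integral>\<omega>. max (- x n \<omega>) 0 \<partial>M) \<le> C"
  shows "AE \<omega> in M. liminf (\<lambda>n. ereal (x n \<omega>)) = limsup (\<lambda>n. ereal (x n \<omega>))"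
proof -
  have "AE \<omega> in M. \<forall>a b :: rat. a < b \<longrightarrow>
      (\<exists>k. \<forall>n. upcrossings (of_rat a) (of_rat b) (\<lambda>t. x t \<omega>) n \<le> k)"
    unfolding AE_all_countable
    by (intro allI AE_impI AE_bounded_upcrossings[OF _ bdd]) (simp add: of_rat_less)
  then show ?thesis
  proof eventually_elim
    case (elim \<omega>)
    show ?case
    proof (rule ccontr)
      assume "\<not> ?case"
      then have "liminf (\<lambda>n. ereal (x n \<omega>)) < limsup (\<lambda>n. ereal (x n \<omega>))"
        using Liminf_le_Limsup[of sequentially] by (simp add: order.strict_iff_order)
      then obtain p q :: rat where pq: "p < q" "\<exists>\<^sub>F n in sequentially. x n \<omega> < of_rat p"
          "\<exists>\<^sub>F n in sequentially. of_rat q < x n \<omega>"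
        by (rule liminf_less_limsup_crosses)
      then show False
        using elim bounded_upcrossings_contradiction[OF _ pq(2,3)] by blast
    qed
  qed
qed

end

end

section \<open>Sublinear expectations and their representing measures\<close>

lemma ext_expectation_abs:
  "ext_expectation P (\<lambda>\<omega>. \<bar>X \<omega>\<bar>) = enn2ereal (\<integral>\<^sup>+\<omega>. e2ennreal \<bar>X \<omega>\<bar> \<partial>P)"
proof -
  have "e2ennreal (- \<bar>X \<omega>\<bar>) = 0" for \<omega>
    by (rule e2ennreal_neg) simp
  then show ?thesis
    by (simp add: ext_expectation_def zero_ennreal.rep_eq)
qed

text \<open>Integrability makes both parts finite, so the difference in the extended reals is one of
  two real numbers.\<close>

lemma ext_expectation_eq_integral:
  assumes "integrable P Y"
  shows "ext_expectation P (\<lambda>\<omega>. ereal (Y \<omega>)) = ereal (integral\<^sup>L P Y)"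
proof -
  have "(\<integral>\<^sup>+\<omega>. ennreal (Y \<omega>) \<partial>P) < \<infinity>" "(\<integral>\<^sup>+\<omega>. ennreal (- Y \<omega>) \<partial>P) < \<infinity>"
    using assms by (auto simp: real_integrable_def less_top)
  then show ?thesis
    using real_lebesgue_integral_def[OF assms]
    by (cases "\<integral>\<^sup>+\<omega>. ennreal (Y \<omega>) \<partial>P"; cases "\<integral>\<^sup>+\<omega>. ennreal (- Y \<omega>) \<partial>P")
      (simp_all add: ext_expectation_def enn2ereal_ennreal)
qed

locale represented_SL_expectation = SL_expectation +
  fixes \<Theta> :: "'a measure set"
  assumes representation: "SL_representation M H E \<Theta>"
begin

lemma H_diff: "Y \<in> H \<Longrightarrow> Z \<in> H \<Longrightarrow> (\<lambda>\<omega>. Y \<omega> - Z \<omega>) \<in> H"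
  using H_add[OF _ H_scale[of Z "-1"], of Y] by simp

lemma H_neg_part: "Y \<in> H \<Longrightarrow> (\<lambda>\<omega>. max (- Y \<omega>) 0) \<in> H"
proof -
  assume "Y \<in> H"
  then have "(\<lambda>\<omega>. 1 / 2 * (\<bar>Y \<omega>\<bar> - Y \<omega>)) \<in> H"
    by (intro H_scale H_diff H_abs)
  also have "(\<lambda>\<omega>. 1 / 2 * (\<bar>Y \<omega>\<bar> - Y \<omega>)) = (\<lambda>\<omega>. max (- Y \<omega>) 0)"
    by auto
  finally show ?thesis .
qed

lemma sets_F_subset: "sets (F t) \<subseteq> sets M"
  unfolding sets_M by auto

lemma prob_space_Theta: "P \<in> \<Theta> \<Longrightarrow> prob_space P"
  and sets_Theta: "P \<in> \<Theta> \<Longrightarrow> sets P = sets M"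
  and mean_eq_E_ext: "Y \<in> H \<Longrightarrow> ereal (SL_mean M E Y) = E_ext \<Theta> (\<lambda>\<omega>. ereal (Y \<omega>))"
  using representation[unfolded SL_representation_def] by simp_all

lemma space_Theta: "P \<in> \<Theta> \<Longrightarrow> space P = space M"
  by (rule sets_eq_imp_space_eq) (rule sets_Theta)

lemma measurable_Theta: "P \<in> \<Theta> \<Longrightarrow> f \<in> measurable M N \<Longrightarrow> f \<in> measurable P N"
  by (simp cong: measurable_cong_sets add: sets_Theta)

text \<open>The supremum over an empty family would be minus infinity, while the mean of the zero
  function is a real number.\<close>

lemma Theta_nonempty: "\<Theta> \<noteq> {}"
  using mean_eq_E_ext[OF H_const[of 0]] by (auto simp: E_ext_def bot_ereal_def)

lemma space_nonempty: "space M \<noteq> {}"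
  using Theta_nonempty prob_space.not_empty[OF prob_space_Theta] space_Theta by fastforce

lemma H_integrable:
  assumes "P \<in> \<Theta>" "Y \<in> H"
  shows "integrable P Y"
proof (rule integrableI_bounded)
  show "Y \<in> borel_measurable P"
    using measurable_Theta assms H_measurable by blast
  have "ext_expectation P (\<lambda>\<omega>. \<bar>ereal (Y \<omega>)\<bar>) \<le> ereal (SL_mean M E (\<lambda>\<omega>. \<bar>Y \<omega>\<bar>))"
    unfolding mean_eq_E_ext[OF H_abs[OF assms(2)]] E_ext_def
    using assms by (intro SUP_upper2[of P]) auto
  then have "enn2ereal (\<integral>\<^sup>+\<omega>. ennreal \<bar>Y \<omega>\<bar> \<partial>P) \<le> ereal (SL_mean M E (\<lambda>\<omega>. \<bar>Y \<omega>\<bar>))"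
    unfolding ext_expectation_abs by simp
  then show "(\<integral>\<^sup>+\<omega>. ennreal (norm (Y \<omega>)) \<partial>P) < \<infinity>"
    by (cases "\<integral>\<^sup>+\<omega>. ennreal \<bar>Y \<omega>\<bar> \<partial>P") auto
qed

lemma SUP_integral_eq_mean:
  assumes "Y \<in> H"
  shows "(SUP P\<in>\<Theta>. ereal (integral\<^sup>L P Y)) = ereal (SL_mean M E Y)"
  unfolding mean_eq_E_ext[OF assms] E_ext_def
  using assms by (intro SUP_cong) (simp_all add: ext_expectation_eq_integral H_integrable)

lemma integral_le_mean: "P \<in> \<Theta> \<Longrightarrow> Y \<in> H \<Longrightarrow> integral\<^sup>L P Y \<le> SL_mean M E Y"
  using SUP_integral_eq_mean[of Y] SUP_upper[of P \<Theta> "\<lambda>P. ereal (integral\<^sup>L P Y)"] by simp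

lemma mean_le:
  assumes "Y \<in> H" "\<And>P. P \<in> \<Theta> \<Longrightarrow> integral\<^sup>L P Y \<le> c"
  shows "SL_mean M E Y \<le> c"
proof -
  have "(SUP P\<in>\<Theta>. ereal (integral\<^sup>L P Y)) \<le> ereal c"
    using assms(2) by (intro SUP_least) simp
  then show ?thesis
    by (simp add: SUP_integral_eq_mean assms(1))
qed

text \<open>The level set of \<open>E 0 Y\<close> through a given point is a nonempty event of the
  trivial \<open>F 0\<close>, hence the whole space. Thus the definite description in
  \<open>SL_mean\<close> has exactly one candidate.\<close>

lemma E_0_eq_mean:
  assumes "Y \<in> H" "\<omega> \<in> space M"
  shows "E 0 Y \<omega> = SL_mean M E Y"
proof -
  have [measurable]: "E 0 Y \<in> borel_measurable (F 0)"
    using E_range assms by auto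
  have "{\<omega>'\<in>space (F 0). E 0 Y \<omega>' = E 0 Y \<omega>} \<in> sets (F 0)"
    by measurable
  then have "{\<omega>'\<in>space M. E 0 Y \<omega>' = E 0 Y \<omega>} = space M"
    using assms(2) by (auto simp: trivial_F0 space_F)
  then have "(THE c. \<forall>\<omega>'\<in>space M. E 0 Y \<omega>' = c) = E 0 Y \<omega>"
    by (intro the_equality, blast) (use assms(2) in auto)
  then show ?thesis
    by (simp add: SL_mean_def)
qed

text \<open>The excess of \<open>Y\<close> over \<open>E s Y\<close>, restricted to
  \<open>A\<close>, has nonpositive \<open>E s\<close>. By the tower property and monotonicity its
  mean is nonpositive too, and the mean dominates integration under \<open>P\<close>.\<close>

lemma integral_indicator_le_E:
  assumes P: "P \<in> \<Theta>" and Y: "Y \<in> H" and A: "A \<in> sets (F s)"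
  shows "(\<integral>\<omega>. indicator A \<omega> * Y \<omega> \<partial>P) \<le> (\<integral>\<omega>. indicator A \<omega> * E s Y \<omega> \<partial>P)"
proof -
  have EY: "E s Y \<in> H" "E s Y \<in> borel_measurable (F s)"
    using E_range[OF Y] by auto
  have AM: "A \<in> sets M"
    using A sets_F_subset by auto
  define D where "D = (\<lambda>\<omega>. indicat_real A \<omega> * (Y \<omega> - E s Y \<omega>))"
  have D: "D \<in> H"
    unfolding D_def by (intro H_indicator H_diff AM Y EY)
  have nEY: "(\<lambda>\<omega>. - E s Y \<omega>) \<in> H"
    using H_scale[OF EY(1), of "-1"] by simp
  have "E s D \<omega> \<le> 0" if w: "\<omega> \<in> space M" for \<omega>
  proof -
    \<comment> \<open>\<open>E s Y\<close> is known at time \<open>s\<close>, so \<open>E s\<close>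
      fixes its negative; this is what makes subadditivity sharp enough to give the bound 0.\<close>
    have "E s (\<lambda>\<omega>. - E s Y \<omega>) \<omega> = - E s Y \<omega>"
      using E_adapted[OF nEY, of s] EY w by auto
    moreover have "E s (\<lambda>\<omega>. Y \<omega> + - E s Y \<omega>) \<omega> \<le> E s Y \<omega> + E s (\<lambda>\<omega>. - E s Y \<omega>) \<omega>"
      using E_subadd[OF Y nEY] w by auto
    ultimately have "E s (\<lambda>\<omega>. Y \<omega> - E s Y \<omega>) \<omega> \<le> 0"
      by simp
    moreover have "E s D \<omega> = indicator A \<omega> * E s (\<lambda>\<omega>. Y \<omega> - E s Y \<omega>) \<omega>"
      unfolding D_def using E_indicator[OF A H_diff[OF Y EY(1)]] w by auto
    ultimately show ?thesis
      by (simp add: indicator_def)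
  qed
  then have le: "\<forall>\<omega>\<in>space M. E 0 (E s D) \<omega> \<le> E 0 (\<lambda>_. 0) \<omega>"
    using E_range[OF D] by (intro E_mono H_const) auto
  obtain \<omega> where w: "\<omega> \<in> space M"
    using space_nonempty by auto
  have "SL_mean M E D = E 0 (E s D) \<omega>"
    using E_0_eq_mean[OF D w] E_tower[OF _ D, of 0 s] w by auto
  also have "\<dots> \<le> E 0 (\<lambda>_. 0) \<omega>"
    using le w by auto
  also have "\<dots> = 0"
    using E_adapted[OF H_const, of 0 0] w by auto
  finally have "integral\<^sup>L P D \<le> 0"
    using integral_le_mean[OF P D] by simp
  moreover have "integral\<^sup>L P D
    = (\<integral>\<omega>. indicator A \<omega> * Y \<omega> \<partial>P) - (\<integral>\<omega>. indicator A \<omega> * E s Y \<omega> \<partial>P)"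
    unfolding D_def right_diff_distrib
    using P AM Y EY by (intro Bochner_Integration.integral_diff H_integrable H_indicator)
  ultimately show ?thesis
    by simp
qed

section \<open>Convergence in the completion as uniform convergence in mean over the representing
  measures\<close>

lemma L1_tendstoD:
  assumes "L1_tendsto \<Theta> Ys Y" "0 < e"
  shows "\<forall>\<^sub>F n in sequentially. \<forall>P\<in>\<Theta>. (\<integral>\<^sup>+\<omega>. e2ennreal \<bar>ereal (Ys n \<omega>) - Y \<omega>\<bar> \<partial>P) \<le> ennreal e"
proof -
  have "\<forall>\<^sub>F n in sequentially. E_ext \<Theta> (\<lambda>\<omega>. \<bar>ereal (Ys n \<omega>) - Y \<omega>\<bar>) < ereal e"
    using assms unfolding L1_tendsto_def by (intro order_tendstoD(2)) auto
  then show ?thesis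
  proof eventually_elim
    case (elim n)
    show ?case
    proof
      fix P assume "P \<in> \<Theta>"
      then have "ext_expectation P (\<lambda>\<omega>. \<bar>ereal (Ys n \<omega>) - Y \<omega>\<bar>) < ereal e"
        using elim unfolding E_ext_def by (meson SUP_upper le_less_trans)
      then show "(\<integral>\<^sup>+\<omega>. e2ennreal \<bar>ereal (Ys n \<omega>) - Y \<omega>\<bar> \<partial>P) \<le> ennreal e"
        unfolding ext_expectation_abs
        by (cases "\<integral>\<^sup>+\<omega>. e2ennreal \<bar>ereal (Ys n \<omega>) - Y \<omega>\<bar> \<partial>P") (auto intro: ennreal_leI)
    qed
  qed
qed

text \<open>Together with \<open>L1_tendstoD\<close> this trades the supremum \<open>E_ext\<close>
  for integral estimates uniform over \<open>\<Theta>\<close>.\<close>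

lemma L1_tendstoI:
  assumes "\<And>e. 0 < e \<Longrightarrow>
    \<forall>\<^sub>F n in sequentially. \<forall>P\<in>\<Theta>. (\<integral>\<^sup>+\<omega>. e2ennreal \<bar>ereal (Ys n \<omega>) - Y \<omega>\<bar> \<partial>P) \<le> ennreal e"
  shows "L1_tendsto \<Theta> Ys Y"
  unfolding L1_tendsto_def
proof (rule order_tendstoI)
  fix a :: ereal assume a: "a < 0"
  \<comment> \<open>Each member of the supremum is nonnegative, but the supremum itself is so only
    because \<open>\<Theta>\<close> is nonempty.\<close>
  have "0 \<le> E_ext \<Theta> (\<lambda>\<omega>. \<bar>ereal (Ys n \<omega>) - Y \<omega>\<bar>)" for n
    using Theta_nonempty unfolding E_ext_def by (auto simp: ext_expectation_abs intro: SUP_upper2)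
  then show "\<forall>\<^sub>F n in sequentially. a < E_ext \<Theta> (\<lambda>\<omega>. \<bar>ereal (Ys n \<omega>) - Y \<omega>\<bar>)"
    using a by (intro always_eventually) (meson less_le_trans)
next
  fix a :: ereal assume "0 < a"
  then obtain e where e: "0 < ereal e" "ereal e < a"
    using ereal_dense2 by blast
  then have "\<forall>\<^sub>F n in sequentially. \<forall>P\<in>\<Theta>.
      (\<integral>\<^sup>+\<omega>. e2ennreal \<bar>ereal (Ys n \<omega>) - Y \<omega>\<bar> \<partial>P) \<le> ennreal e"
    using assms by simp
  then show "\<forall>\<^sub>F n in sequentially. E_ext \<Theta> (\<lambda>\<omega>. \<bar>ereal (Ys n \<omega>) - Y \<omega>\<bar>) < a"
  proof eventually_elim
    case (elim n)
    have "ext_expectation P (\<lambda>\<omega>. \<bar>ereal (Ys n \<omega>) - Y \<omega>\<bar>) \<le> ereal e" if "P \<in> \<Theta>" for P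
    proof -
      have "enn2ereal (\<integral>\<^sup>+\<omega>. e2ennreal \<bar>ereal (Ys n \<omega>) - Y \<omega>\<bar> \<partial>P) \<le> enn2ereal (ennreal e)"
        using elim that by (simp add: less_eq_ennreal.rep_eq)
      then show ?thesis
        using e by (simp add: ext_expectation_abs)
    qed
    then have "E_ext \<Theta> (\<lambda>\<omega>. \<bar>ereal (Ys n \<omega>) - Y \<omega>\<bar>) \<le> ereal e"
      unfolding E_ext_def by (rule SUP_least)
    then show ?case
      using e by simp
  qed
qed

text \<open>\<open>Z\<close> is real-valued and its distance to \<open>Y\<close> has finite
  integral, so \<open>Y\<close> is infinite at most on a null set of \<open>P\<close>. The default
  value 0 of \<open>real_of_ereal\<close> there does no harm, and real integrals become
  available.\<close>

lemma L1_close: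
  assumes P: "P \<in> \<Theta>" and Z: "Z \<in> H" and Y: "Y \<in> borel_measurable M" and "0 \<le> e"
    and close: "(\<integral>\<^sup>+\<omega>. e2ennreal \<bar>ereal (Z \<omega>) - Y \<omega>\<bar> \<partial>P) \<le> ennreal e"
  shows "AE \<omega> in P. Y \<omega> = ereal (real_of_ereal (Y \<omega>))"
    and "integrable P (\<lambda>\<omega>. real_of_ereal (Y \<omega>))"
    and "(\<integral>\<omega>. \<bar>Z \<omega> - real_of_ereal (Y \<omega>)\<bar> \<partial>P) \<le> e"
proof -
  have [measurable]: "Z \<in> borel_measurable P" "Y \<in> borel_measurable P"
    using measurable_Theta P Y Z H_measurable by blast+
  have "AE \<omega> in P. e2ennreal \<bar>ereal (Z \<omega>) - Y \<omega>\<bar> \<noteq> \<infinity>"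
    using close by (intro nn_integral_noteq_infinite) (auto simp: top_unique)
  then show fin: "AE \<omega> in P. Y \<omega> = ereal (real_of_ereal (Y \<omega>))"
  proof eventually_elim
    case (elim \<omega>)
    then show ?case
      by (cases "Y \<omega>") auto
  qed
  have "(\<integral>\<^sup>+\<omega>. ennreal \<bar>Z \<omega> - real_of_ereal (Y \<omega>)\<bar> \<partial>P)
    = (\<integral>\<^sup>+\<omega>. e2ennreal \<bar>ereal (Z \<omega>) - Y \<omega>\<bar> \<partial>P)"
    using fin by (intro nn_integral_cong_AE, eventually_elim)
      (metis abs_ereal.simps(1) e2ennreal_ereal ereal_minus(1))
  then have le: "(\<integral>\<^sup>+\<omega>. ennreal \<bar>Z \<omega> - real_of_ereal (Y \<omega>)\<bar> \<partial>P) \<le> ennreal e"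
    using close by simp
  have int: "integrable P (\<lambda>\<omega>. Z \<omega> - real_of_ereal (Y \<omega>))"
    using le by (intro integrableI_bounded) (auto simp: less_top[symmetric] top_unique)
  show "integrable P (\<lambda>\<omega>. real_of_ereal (Y \<omega>))"
    using Bochner_Integration.integrable_diff[OF H_integrable[OF P Z] int] by simp
  have "ennreal (\<integral>\<omega>. \<bar>Z \<omega> - real_of_ereal (Y \<omega>)\<bar> \<partial>P) \<le> ennreal e"
    using le int by (subst (asm) nn_integral_eq_integral) auto
  then show "(\<integral>\<omega>. \<bar>Z \<omega> - real_of_ereal (Y \<omega>)\<bar> \<partial>P) \<le> e"
    using \<open>0 \<le> e\<close> by simp
qed

lemma L1_limit_AE_finite:
  assumes "\<And>n. Ys n \<in> H" "L1_tendsto \<Theta> Ys Y" "Y \<in> borel_measurable M" "P \<in> \<Theta>"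
  shows "AE \<omega> in P. Y \<omega> = ereal (real_of_ereal (Y \<omega>))"
    and "integrable P (\<lambda>\<omega>. real_of_ereal (Y \<omega>))"
proof -
  obtain n where "(\<integral>\<^sup>+\<omega>. e2ennreal \<bar>ereal (Ys n \<omega>) - Y \<omega>\<bar> \<partial>P) \<le> ennreal 1"
    using eventually_happens'[OF _ L1_tendstoD[OF assms(2) zero_less_one]] assms(4) by auto
  from L1_close[OF assms(4,1,3) zero_le_one this]
  show "AE \<omega> in P. Y \<omega> = ereal (real_of_ereal (Y \<omega>))"
    and "integrable P (\<lambda>\<omega>. real_of_ereal (Y \<omega>))"
    by blast+
qed

lemma L1_limit_uniform:
  assumes "\<And>n. Ys n \<in> H" "L1_tendsto \<Theta> Ys Y" "Y \<in> borel_measurable M" "0 < e"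
  shows "\<forall>\<^sub>F n in sequentially. \<forall>P\<in>\<Theta>. (\<integral>\<omega>. \<bar>Ys n \<omega> - real_of_ereal (Y \<omega>)\<bar> \<partial>P) \<le> e"
  using L1_tendstoD[OF assms(2,4)]
proof eventually_elim
  case (elim n)
  then show ?case
    using L1_close(3)[OF _ assms(1,3) less_imp_le[OF assms(4)]] by blast
qed

text \<open>One approximant within distance 1 suffices: the mean of its absolute value dominates the
  integrals under all representing measures at once.\<close>

lemma L1_limit_bounded:
  assumes "\<And>n. Ys n \<in> H" "L1_tendsto \<Theta> Ys Y" "Y \<in> borel_measurable M"
  shows "\<exists>K. \<forall>P\<in>\<Theta>. (\<integral>\<omega>. \<bar>real_of_ereal (Y \<omega>)\<bar> \<partial>P) \<le> K"
proof -
  obtain n where n: "\<And>P. P \<in> \<Theta> \<Longrightarrow> (\<integral>\<omega>. \<bar>Ys n \<omega> - real_of_ereal (Y \<omega>)\<bar> \<partial>P) \<le> 1"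
    using eventually_happens'[OF _ L1_limit_uniform[OF assms, of 1]] by auto
  have "(\<integral>\<omega>. \<bar>real_of_ereal (Y \<omega>)\<bar> \<partial>P) \<le> SL_mean M E (\<lambda>\<omega>. \<bar>Ys n \<omega>\<bar>) + 1" if P: "P \<in> \<Theta>" for P
  proof -
    have int: "integrable P (Ys n)" "integrable P (\<lambda>\<omega>. real_of_ereal (Y \<omega>))"
      using H_integrable[OF P assms(1)] L1_limit_AE_finite(2)[OF assms P] by auto
    have "(\<integral>\<omega>. \<bar>real_of_ereal (Y \<omega>)\<bar> \<partial>P) \<le> (\<integral>\<omega>. \<bar>Ys n \<omega>\<bar> + \<bar>Ys n \<omega> - real_of_ereal (Y \<omega>)\<bar> \<partial>P)"
      using int by (intro integral_mono) (auto simp del: abs_real_of_ereal)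
    also have "\<dots> = (\<integral>\<omega>. \<bar>Ys n \<omega>\<bar> \<partial>P) + (\<integral>\<omega>. \<bar>Ys n \<omega> - real_of_ereal (Y \<omega>)\<bar> \<partial>P)"
      using int by simp
    finally show ?thesis
      using n[OF P] integral_le_mean[OF P H_abs[OF assms(1)], of n] by simp
  qed
  then show ?thesis
    by blast
qed

text \<open>Multiplying by an indicator does not increase the distance in mean.\<close>

lemma L1_limit_integral:
  assumes "\<And>n. Ys n \<in> H" "L1_tendsto \<Theta> Ys Y" "Y \<in> borel_measurable M"
    and P: "P \<in> \<Theta>" and A: "A \<in> sets M"
  shows "(\<lambda>n. \<integral>\<omega>. indicator A \<omega> * Ys n \<omega> \<partial>P)
    \<longlonglongrightarrow> (\<integral>\<omega>. indicator A \<omega> * real_of_ereal (Y \<omega>) \<partial>P)"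
proof (rule tendstoI)
  fix e :: real assume "0 < e"
  \<comment> \<open>The uniform estimate is a weak inequality; \<open>e / 2\<close> leaves room for
    the strict one that the limit demands.\<close>
  then have "\<forall>\<^sub>F n in sequentially. \<forall>P\<in>\<Theta>. (\<integral>\<omega>. \<bar>Ys n \<omega> - real_of_ereal (Y \<omega>)\<bar> \<partial>P) \<le> e / 2"
    by (intro L1_limit_uniform assms) auto
  then show "\<forall>\<^sub>F n in sequentially. dist (\<integral>\<omega>. indicator A \<omega> * Ys n \<omega> \<partial>P)
      (\<integral>\<omega>. indicator A \<omega> * real_of_ereal (Y \<omega>) \<partial>P) < e"
  proof eventually_elim
    case (elim n)
    have int: "integrable P (Ys n)" "integrable P (\<lambda>\<omega>. real_of_ereal (Y \<omega>))"
      using H_integrable L1_limit_AE_finite[OF assms(1,2,3) P] P assms(1) by auto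
    have A': "A \<in> sets P"
      using A sets_Theta[OF P] by simp
    note intA = integrable_mult_indicator[OF A' int(1), simplified]
      integrable_mult_indicator[OF A' int(2), simplified]
    have "\<bar>(\<integral>\<omega>. indicator A \<omega> * Ys n \<omega> \<partial>P) - (\<integral>\<omega>. indicator A \<omega> * real_of_ereal (Y \<omega>) \<partial>P)\<bar>
      = \<bar>\<integral>\<omega>. indicator A \<omega> * Ys n \<omega> - indicator A \<omega> * real_of_ereal (Y \<omega>) \<partial>P\<bar>"
      using intA by simp
    also have "\<dots> \<le> (\<integral>\<omega>. \<bar>indicator A \<omega> * Ys n \<omega> - indicator A \<omega> * real_of_ereal (Y \<omega>)\<bar> \<partial>P)"
      by (rule integral_abs_bound)
    also have "\<dots> \<le> (\<integral>\<omega>. \<bar>Ys n \<omega> - real_of_ereal (Y \<omega>)\<bar> \<partial>P)"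
      using int intA by (intro integral_mono) (auto simp: indicator_def)
    also have "\<dots> \<le> e / 2"
      using elim P by auto
    finally show ?case
      using \<open>0 < e\<close> by (simp add: dist_real_def)
  qed
qed

section \<open>The extended mean as a supremum of expectations\<close>

text \<open>Two suprema differ by at most the largest difference between corresponding members,
  which is small uniformly over \<open>\<Theta>\<close>. Boundedness is recorded because the
  supremum is one of reals.\<close>

lemma L1_mean_tendsto:
  assumes "\<And>n. Ys n \<in> H" "L1_tendsto \<Theta> Ys Y" "Y \<in> borel_measurable M"
  shows "bdd_above ((\<lambda>P. \<integral>\<omega>. real_of_ereal (Y \<omega>) \<partial>P) ` \<Theta>)"
    and "(\<lambda>n. SL_mean M E (Ys n)) \<longlonglongrightarrow> (SUP P\<in>\<Theta>. \<integral>\<omega>. real_of_ereal (Y \<omega>) \<partial>P)"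
proof -
  obtain K where K: "\<And>P. P \<in> \<Theta> \<Longrightarrow> (\<integral>\<omega>. \<bar>real_of_ereal (Y \<omega>)\<bar> \<partial>P) \<le> K"
    using L1_limit_bounded[OF assms] by blast
  have "(\<integral>\<omega>. real_of_ereal (Y \<omega>) \<partial>P) \<le> K" if "P \<in> \<Theta>" for P
    using K[OF that] integral_abs_bound[of P "\<lambda>\<omega>. real_of_ereal (Y \<omega>)"] by linarith
  then show bdd: "bdd_above ((\<lambda>P. \<integral>\<omega>. real_of_ereal (Y \<omega>) \<partial>P) ` \<Theta>)"
    by (intro bdd_aboveI2)
  show "(\<lambda>n. SL_mean M E (Ys n)) \<longlonglongrightarrow> (SUP P\<in>\<Theta>. \<integral>\<omega>. real_of_ereal (Y \<omega>) \<partial>P)" (is "_ \<longlonglongrightarrow> ?m")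
  proof (rule tendstoI)
    fix e :: real assume "0 < e"
    then have "\<forall>\<^sub>F n in sequentially. \<forall>P\<in>\<Theta>. (\<integral>\<omega>. \<bar>Ys n \<omega> - real_of_ereal (Y \<omega>)\<bar> \<partial>P) \<le> e / 2"
      by (intro L1_limit_uniform assms) auto
    then show "\<forall>\<^sub>F n in sequentially. dist (SL_mean M E (Ys n)) ?m < e"
    proof eventually_elim
      case (elim n)
      have close: "\<bar>(\<integral>\<omega>. Ys n \<omega> \<partial>P) - (\<integral>\<omega>. real_of_ereal (Y \<omega>) \<partial>P)\<bar> \<le> e / 2" if P: "P \<in> \<Theta>" for P
      proof -
        have "(\<integral>\<omega>. Ys n \<omega> \<partial>P) - (\<integral>\<omega>. real_of_ereal (Y \<omega>) \<partial>P) = (\<integral>\<omega>. Ys n \<omega> - real_of_ereal (Y \<omega>) \<partial>P)"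
          using H_integrable[OF P assms(1)] L1_limit_AE_finite(2)[OF assms P] by simp
        then show ?thesis
          using bspec[OF elim P] integral_abs_bound[of P "\<lambda>\<omega>. Ys n \<omega> - real_of_ereal (Y \<omega>)"]
          by linarith
      qed
      have "SL_mean M E (Ys n) \<le> ?m + e / 2"
      proof (rule mean_le[OF assms(1)])
        fix P assume P: "P \<in> \<Theta>"
        show "integral\<^sup>L P (Ys n) \<le> ?m + e / 2"
          using close[OF P] cSUP_upper[OF P bdd] by linarith
      qed
      moreover have "?m \<le> SL_mean M E (Ys n) + e / 2"
      proof (rule cSUP_least[OF Theta_nonempty])
        fix P assume P: "P \<in> \<Theta>"
        show "(\<integral>\<omega>. real_of_ereal (Y \<omega>) \<partial>P) \<le> SL_mean M E (Ys n) + e / 2"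
          using close[OF P] integral_le_mean[OF P assms(1)[of n]] by linarith
      qed
      ultimately show ?case
        using \<open>0 < e\<close> unfolding dist_real_def by linarith
    qed
  qed
qed

lemma SL_mean_E_0:
  assumes "Y \<in> H"
  shows "SL_mean M E (E 0 Y) = SL_mean M E Y"
proof -
  obtain \<omega> where "\<omega> \<in> space M"
    using space_nonempty by auto
  then show ?thesis
    using E_tower[of 0 0 Y] E_0_eq_mean[of Y \<omega>] E_0_eq_mean[of "E 0 Y" \<omega>] E_range[of Y 0] assms by auto
qed

text \<open>Serves the membership condition that \<open>L1_version\<close> puts on its last
  argument.\<close>

lemma const_in_SL_L1: "(\<lambda>_. ereal c) \<in> SL_L1 M H E \<Theta>"
proof -
  have "SL_mean M E (\<lambda>_. 0) \<le> 0"
    by (rule mean_le) (auto intro: H_const)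
  then have "L1_Cauchy M H E (\<lambda>_ _. c)"
    unfolding L1_Cauchy_def by (auto intro: H_const)
  moreover have "L1_tendsto \<Theta> (\<lambda>_ _. c) (\<lambda>_. ereal c)"
    by (rule L1_tendstoI) (simp add: zero_ereal_def[symmetric])
  moreover have "(\<lambda>_. ereal c) \<in> H_ext M \<Theta>"
    using prob_space.emeasure_space_1[OF prob_space_Theta] by (auto simp: H_ext_def min_less_iff_disj)
  ultimately show ?thesis
    unfolding SL_L1_def by blast
qed

text \<open>Along any sequence approximating \<open>Y\<close> the means converge to the same
  supremum, which determines \<open>c\<close>. Conversely \<open>E 0 (Ys n)\<close> is constantly
  the mean of \<open>Ys n\<close>, so the supremum does occur. Hence \<open>L1_mean\<close> is well
  defined.\<close>

lemma L1_version_0_iff: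
  assumes "\<And>n. Ys n \<in> H" "L1_tendsto \<Theta> Ys Y" "Y \<in> borel_measurable M"
  shows "L1_version M H E \<Theta> 0 Y (\<lambda>_. ereal c) \<longleftrightarrow> c = (SUP P\<in>\<Theta>. \<integral>\<omega>. real_of_ereal (Y \<omega>) \<partial>P)"
    (is "_ \<longleftrightarrow> c = ?m")
proof
  assume "L1_version M H E \<Theta> 0 Y (\<lambda>_. ereal c)"
  then obtain Xs where Xs: "\<And>n. Xs n \<in> H" "L1_tendsto \<Theta> Xs Y"
      "L1_tendsto \<Theta> (\<lambda>n. E 0 (Xs n)) (\<lambda>_. ereal c)"
    unfolding L1_version_def by blast
  have "(\<lambda>n. SL_mean M E (E 0 (Xs n))) \<longlonglongrightarrow> (SUP P\<in>\<Theta>. \<integral>\<omega>. real_of_ereal (ereal c) \<partial>P)"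
    using E_range Xs by (intro L1_mean_tendsto(2)) auto
  \<comment> \<open>Under a probability measure a constant is its own expectation.\<close>
  moreover have "(SUP P\<in>\<Theta>. \<integral>\<omega>. real_of_ereal (ereal c) \<partial>P) = (SUP P\<in>\<Theta>. c)"
    using prob_space.prob_space[OF prob_space_Theta] by (intro SUP_cong) auto
  ultimately have "(\<lambda>n. SL_mean M E (Xs n)) \<longlonglongrightarrow> c"
    using Theta_nonempty by (simp add: SL_mean_E_0 Xs(1))
  then show "c = ?m"
    using L1_mean_tendsto(2)[OF Xs(1,2) assms(3)] LIMSEQ_unique by blast
next
  assume c: "c = ?m"
  have "L1_tendsto \<Theta> (\<lambda>n. E 0 (Ys n)) (\<lambda>_. ereal c)"
  proof (rule L1_tendstoI)
    fix e :: real assume "0 < e"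
    then have "\<forall>\<^sub>F n in sequentially. \<bar>SL_mean M E (Ys n) - c\<bar> < e"
      using L1_mean_tendsto(2)[OF assms] unfolding c tendsto_iff dist_real_def by blast
    then show "\<forall>\<^sub>F n in sequentially. \<forall>P\<in>\<Theta>.
        (\<integral>\<^sup>+\<omega>. e2ennreal \<bar>ereal (E 0 (Ys n) \<omega>) - ereal c\<bar> \<partial>P) \<le> ennreal e"
    proof eventually_elim
      case (elim n)
      show ?case
      proof
        fix P assume P: "P \<in> \<Theta>"
        have "(\<integral>\<^sup>+\<omega>. e2ennreal \<bar>ereal (E 0 (Ys n) \<omega>) - ereal c\<bar> \<partial>P)
          = (\<integral>\<^sup>+\<omega>. ennreal \<bar>SL_mean M E (Ys n) - c\<bar> \<partial>P)"
          using assms(1) by (intro nn_integral_cong) (simp add: E_0_eq_mean space_Theta[OF P])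
        also have "\<dots> \<le> ennreal e"
          using elim prob_space.emeasure_space_1[OF prob_space_Theta[OF P]] by (simp add: ennreal_leI)
        finally show "(\<integral>\<^sup>+\<omega>. e2ennreal \<bar>ereal (E 0 (Ys n) \<omega>) - ereal c\<bar> \<partial>P) \<le> ennreal e" .
      qed
    qed
  qed
  then show "L1_version M H E \<Theta> 0 Y (\<lambda>_. ereal c)"
    unfolding L1_version_def using assms const_in_SL_L1 by blast
qed

text \<open>Taking negative parts is a contraction, so negative parts of approximants approximate
  the negative part of \<open>Y\<close>, and its extended mean is the supremum of the
  integrals.\<close>

lemma integral_neg_part_le_L1_mean:
  assumes Y: "Y \<in> SL_L1 M H E \<Theta>" and P: "P \<in> \<Theta>"
  shows "(\<integral>\<omega>. max (- real_of_ereal (Y \<omega>)) 0 \<partial>P) \<le> L1_mean M H E \<Theta> (\<lambda>\<omega>. max (- Y \<omega>) 0)"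
proof -
  obtain Ys where Ys: "\<And>n. Ys n \<in> H" "L1_tendsto \<Theta> Ys Y"
    using Y by (auto simp: SL_L1_def L1_Cauchy_def)
  have [measurable]: "Y \<in> borel_measurable M"
    using Y by (auto simp: SL_L1_def H_ext_def)
  let ?Ws = "\<lambda>n \<omega>. max (- Ys n \<omega>) 0" and ?W = "\<lambda>\<omega>. max (- Y \<omega>) 0"
  have W: "L1_tendsto \<Theta> ?Ws ?W"
  proof (rule L1_tendstoI)
    fix e :: real assume "0 < e"
    from L1_tendstoD[OF Ys(2) this]
    show "\<forall>\<^sub>F n in sequentially. \<forall>P\<in>\<Theta>. (\<integral>\<^sup>+\<omega>. e2ennreal \<bar>ereal (?Ws n \<omega>) - ?W \<omega>\<bar> \<partial>P) \<le> ennreal e"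
    proof eventually_elim
      case (elim n)
      have "\<bar>ereal (?Ws n \<omega>) - ?W \<omega>\<bar> \<le> \<bar>ereal (Ys n \<omega>) - Y \<omega>\<bar>" for \<omega>
        by (cases "Y \<omega>") (auto simp: max_def zero_ereal_def)
      then have "(\<integral>\<^sup>+\<omega>. e2ennreal \<bar>ereal (?Ws n \<omega>) - ?W \<omega>\<bar> \<partial>P)
          \<le> (\<integral>\<^sup>+\<omega>. e2ennreal \<bar>ereal (Ys n \<omega>) - Y \<omega>\<bar> \<partial>P)" for P
        by (intro nn_integral_mono e2ennreal_mono)
      then show ?case
        using elim order_trans by blast
    qed
  qed
  have Wm: "?W \<in> borel_measurable M"
    by measurable
  have "L1_mean M H E \<Theta> ?W = (SUP P\<in>\<Theta>. \<integral>\<omega>. real_of_ereal (?W \<omega>) \<partial>P)"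
    unfolding L1_mean_def
    by (simp add: L1_version_0_iff[OF H_neg_part[OF Ys(1)] W Wm])
  moreover have "(\<integral>\<omega>. real_of_ereal (?W \<omega>) \<partial>P) \<le> (SUP P\<in>\<Theta>. \<integral>\<omega>. real_of_ereal (?W \<omega>) \<partial>P)"
    using cSUP_upper[OF P L1_mean_tendsto(1)[OF H_neg_part[OF Ys(1)] W Wm]] .
  \<comment> \<open>At infinite values of \<open>Y\<close> both sides are 0, since
    \<open>real_of_ereal\<close> sends both infinities to 0.\<close>
  moreover have "real_of_ereal (?W \<omega>) = max (- real_of_ereal (Y \<omega>)) 0" for \<omega>
    by (cases "Y \<omega>") (auto simp: max_def zero_ereal_def)
  ultimately show ?thesis
    by simp
qed

section \<open>Polar sets and quasi-sure statements\<close>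

text \<open>The mean of the indicator is the supremum of the probabilities of \<open>N\<close>, all
  of them nonnegative.\<close>

lemma mean_indicator_eq_0_iff:
  assumes "N \<in> sets M"
  shows "SL_mean M E (indicat_real N) = 0 \<longleftrightarrow> (\<forall>P\<in>\<Theta>. N \<in> null_sets P)"
proof -
  have H: "indicat_real N \<in> H"
    using H_indicator[OF assms H_const[of 1]] by simp
  have int: "integral\<^sup>L P (indicat_real N) = measure P N" if "P \<in> \<Theta>" for P
    using assms that by (simp add: sets_Theta[OF that])
  have null: "N \<in> null_sets P \<longleftrightarrow> measure P N = 0" if "P \<in> \<Theta>" for P
  proof -
    interpret prob_space P
      using that by (rule prob_space_Theta)
    show ?thesis
      using assms that by (auto simp: null_sets_def emeasure_eq_measure sets_Theta)
  qed
  show ?thesis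
  proof
    assume "SL_mean M E (indicat_real N) = 0"
    then show "\<forall>P\<in>\<Theta>. N \<in> null_sets P"
      using integral_le_mean[OF _ H] int null by (metis measure_le_0_iff)
  next
    assume *: "\<forall>P\<in>\<Theta>. N \<in> null_sets P"
    then have "SL_mean M E (indicat_real N) \<le> 0"
      using int null by (intro mean_le H) auto
    moreover obtain P where "P \<in> \<Theta>"
      using Theta_nonempty by auto
    then have "0 \<le> SL_mean M E (indicat_real N)"
      using integral_le_mean[OF _ H, of P] int[of P] null[of P] * by auto
    ultimately show "SL_mean M E (indicat_real N) = 0"
      by simp
  qed
qed

lemma quasi_surely_imp_AE:
  assumes "quasi_surely M E Q" "P \<in> \<Theta>"
  shows "AE \<omega> in P. Q \<omega>"
proof -
  obtain N where "N \<in> sets M" "SL_mean M E (indicat_real N) = 0" "\<forall>\<omega>\<in>space M - N. Q \<omega>"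
    using assms(1) by (auto simp: quasi_surely_def)
  then show ?thesis
    using assms(2) by (intro AE_I'[of N]) (auto simp: mean_indicator_eq_0_iff space_Theta)
qed

text \<open>The null sets of the individual measures may differ, and \<open>\<Theta>\<close> may be
  uncountable, so their union is of no help. The failure set of \<open>Q\<close> is a single set
  that serves all measures, provided it is measurable.\<close>

lemma quasi_surelyI:
  assumes "{\<omega>\<in>space M. \<not> Q \<omega>} \<in> sets M" "\<And>P. P \<in> \<Theta> \<Longrightarrow> AE \<omega> in P. Q \<omega>"
  shows "quasi_surely M E Q"
proof -
  have "{\<omega>\<in>space M. \<not> Q \<omega>} \<in> null_sets P" if "P \<in> \<Theta>" for P
    using AE_iff_null[of P Q] assms that by (simp add: sets_Theta space_Theta)
  then show ?thesis
    unfolding quasi_surely_def using assms(1)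
    by (intro bexI[of _ "{\<omega>\<in>space M. \<not> Q \<omega>}"]) (auto simp: mean_indicator_eq_0_iff)
qed

section \<open>Supermartingales under all representing measures at once\<close>

context
  fixes X :: "nat \<Rightarrow> 'a \<Rightarrow> ereal"
  assumes super: "SL_supermartingale M F H E \<Theta> X"
begin

lemma supermartingale_SL_L1: "X t \<in> SL_L1 M H E \<Theta>" "X t \<in> borel_measurable (F t)"
  using super by (auto simp: SL_supermartingale_def)

lemma supermartingale_approx: "X t \<in> borel_measurable M" "\<exists>Xs. (\<forall>n. Xs n \<in> H) \<and> L1_tendsto \<Theta> Xs (X t)"
  using supermartingale_SL_L1(1)[of t] by (auto simp: SL_L1_def H_ext_def L1_Cauchy_def)

lemma supermartingale_AE_finite:
  assumes "P \<in> \<Theta>"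
  shows "AE \<omega> in P. X t \<omega> = ereal (real_of_ereal (X t \<omega>))"
    and "integrable P (\<lambda>\<omega>. real_of_ereal (X t \<omega>))"
proof -
  obtain Xs where "\<And>n. Xs n \<in> H" "L1_tendsto \<Theta> Xs (X t)"
    using supermartingale_approx(2)[of t] by blast
  from L1_limit_AE_finite[OF this supermartingale_approx(1) assms]
  show "AE \<omega> in P. X t \<omega> = ereal (real_of_ereal (X t \<omega>))"
    and "integrable P (\<lambda>\<omega>. real_of_ereal (X t \<omega>))"
    by this
qed

text \<open>The inequality between \<open>Y\<close> and \<open>E s Y\<close> on events of
  \<open>F s\<close> passes to limits in the completion, and a quasi-sure inequality holds almost
  surely under \<open>P\<close>.\<close>

lemma supermartingale_integral:
  assumes P: "P \<in> \<Theta>" and "s \<le> t" and A: "A \<in> sets (F s)"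
  shows "(\<integral>\<omega>. indicator A \<omega> * real_of_ereal (X t \<omega>) \<partial>P)
    \<le> (\<integral>\<omega>. indicator A \<omega> * real_of_ereal (X s \<omega>) \<partial>P)"
proof -
  have AM: "A \<in> sets M"
    using A sets_F_subset by blast
  have AP: "A \<in> sets P"
    using AM P by (simp add: sets_Theta)
  obtain Z where Z: "L1_version M H E \<Theta> s (X t) Z" "quasi_surely M E (\<lambda>\<omega>. Z \<omega> \<le> X s \<omega>)"
    using super \<open>s \<le> t\<close> unfolding SL_supermartingale_def by blast
  then obtain Xs where Xs: "\<And>n. Xs n \<in> H" "L1_tendsto \<Theta> Xs (X t)" "L1_tendsto \<Theta> (\<lambda>n. E s (Xs n)) Z"
    and Zm: "Z \<in> borel_measurable M"
    unfolding L1_version_def SL_L1_def H_ext_def by blast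
  have EXs: "E s (Xs n) \<in> H" for n
    using E_range[OF Xs(1)] by auto
  note finZ = L1_limit_AE_finite[OF EXs Xs(3) Zm P]
  note finX = supermartingale_AE_finite[OF P, of s]
  \<comment> \<open>One sequence \<open>Xs\<close> drives both limits: it approximates
    \<open>X t\<close>, while its images under \<open>E s\<close> approximate
    \<open>Z\<close>.\<close>
  have "(\<integral>\<omega>. indicator A \<omega> * real_of_ereal (X t \<omega>) \<partial>P) \<le> (\<integral>\<omega>. indicator A \<omega> * real_of_ereal (Z \<omega>) \<partial>P)"
    using L1_limit_integral[OF Xs(1,2) supermartingale_approx(1) P AM]
      L1_limit_integral[OF EXs Xs(3) Zm P AM]
    by (rule LIMSEQ_le) (use integral_indicator_le_E[OF P Xs(1) A] in auto)
  also have "\<dots> \<le> (\<integral>\<omega>. indicator A \<omega> * real_of_ereal (X s \<omega>) \<partial>P)"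
  proof (rule integral_mono_AE)
    show "integrable P (\<lambda>\<omega>. indicator A \<omega> * real_of_ereal (Z \<omega>))"
      "integrable P (\<lambda>\<omega>. indicator A \<omega> * real_of_ereal (X s \<omega>))"
      using integrable_mult_indicator[OF AP finZ(2)] integrable_mult_indicator[OF AP finX(2)] by simp_all
    show "AE \<omega> in P. indicator A \<omega> * real_of_ereal (Z \<omega>) \<le> indicator A \<omega> * real_of_ereal (X s \<omega>)"
      using quasi_surely_imp_AE[OF Z(2) P] finZ(1) finX(1)
    proof eventually_elim
      case (elim \<omega>)
      then have "real_of_ereal (Z \<omega>) \<le> real_of_ereal (X s \<omega>)"
        by (metis ereal_less_eq(3))
      then show ?case
        by (rule mult_left_mono) simp
    qed
  qed
  finally show ?thesis .
qed

text \<open>The classical theorem applies to the real-valued versions, which agree with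
  \<open>X\<close> at all times simultaneously outside a null set.\<close>

lemma supermartingale_AE_liminf_eq_limsup:
  assumes C: "\<And>k. L1_mean M H E \<Theta> (\<lambda>\<omega>. max (- X k \<omega>) 0) \<le> C" and P: "P \<in> \<Theta>"
  shows "AE \<omega> in P. liminf (\<lambda>n. X n \<omega>) = limsup (\<lambda>n. X n \<omega>)"
proof -
  interpret P: prob_space P
    using P by (rule prob_space_Theta)
  have "AE \<omega> in P. liminf (\<lambda>n. ereal (real_of_ereal (X n \<omega>))) = limsup (\<lambda>n. ereal (real_of_ereal (X n \<omega>)))"
  proof (rule P.supermartingale_AE_convergent)
    show "filtration (space P) F"
      unfolding space_Theta[OF P] by (rule filtration_axioms)
    show "sets (F t) \<subseteq> sets P" for t
      using sets_F_subset by (simp add: sets_Theta[OF P])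
    show "(\<lambda>\<omega>. real_of_ereal (X t \<omega>)) \<in> borel_measurable (F t)" for t
      using supermartingale_SL_L1(2) by measurable
    show "integrable P (\<lambda>\<omega>. real_of_ereal (X t \<omega>))" for t
      by (rule supermartingale_AE_finite(2)[OF P])
    show "(\<integral>\<omega>. indicator A \<omega> * real_of_ereal (X (Suc t) \<omega>) \<partial>P)
      \<le> (\<integral>\<omega>. indicator A \<omega> * real_of_ereal (X t \<omega>) \<partial>P)" if "A \<in> sets (F t)" for t A
      by (rule supermartingale_integral[OF P _ that]) simp
    show "(\<integral>\<omega>. max (- real_of_ereal (X n \<omega>)) 0 \<partial>P) \<le> C" for n
      using integral_neg_part_le_L1_mean[OF supermartingale_SL_L1(1)[of n] P] C[of n] by linarith
  qed
  moreover have "AE \<omega> in P. \<forall>n. X n \<omega> = ereal (real_of_ereal (X n \<omega>))"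
    unfolding AE_all_countable using supermartingale_AE_finite(1)[OF P] by blast
  ultimately show ?thesis
  proof eventually_elim
    case (elim \<omega>)
    have "(\<lambda>n. ereal (real_of_ereal (X n \<omega>))) = (\<lambda>n. X n \<omega>)"
      using elim(2) by (intro ext sym[of "X _ \<omega>"]) blast
    with elim(1) show ?case
      by (simp only:)
  qed
qed

text \<open>An absolute value is the variable plus twice its negative part. Expectations do not
  exceed the initial one, which is bounded uniformly over \<open>\<Theta>\<close>, and
  \<open>C\<close> controls the negative parts.\<close>

lemma supermartingale_L1_bounded:
  assumes C: "\<And>k. L1_mean M H E \<Theta> (\<lambda>\<omega>. max (- X k \<omega>) 0) \<le> C"
  shows "\<exists>K. \<forall>P\<in>\<Theta>. \<forall>n. (\<integral>\<^sup>+\<omega>. e2ennreal \<bar>X n \<omega>\<bar> \<partial>P) \<le> ennreal K"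
proof -
  obtain K where K: "\<And>P. P \<in> \<Theta> \<Longrightarrow> (\<integral>\<omega>. \<bar>real_of_ereal (X 0 \<omega>)\<bar> \<partial>P) \<le> K"
    using supermartingale_approx[of 0] L1_limit_bounded by blast
  have "(\<integral>\<^sup>+\<omega>. e2ennreal \<bar>X n \<omega>\<bar> \<partial>P) \<le> ennreal (K + 2 * C)" if P: "P \<in> \<Theta>" for P n
  proof -
    let ?x = "\<lambda>n \<omega>. real_of_ereal (X n \<omega>)"
    have int: "integrable P (?x n)" for n
      by (rule supermartingale_AE_finite(2)[OF P])
    have "(\<integral>\<^sup>+\<omega>. e2ennreal \<bar>X n \<omega>\<bar> \<partial>P) = (\<integral>\<^sup>+\<omega>. ennreal \<bar>?x n \<omega>\<bar> \<partial>P)"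
      using supermartingale_AE_finite(1)[OF P, of n]
      by (intro nn_integral_cong_AE, eventually_elim) (metis abs_ereal.simps(1) e2ennreal_ereal)
    also have "\<dots> = ennreal (\<integral>\<omega>. \<bar>?x n \<omega>\<bar> \<partial>P)"
      by (intro nn_integral_eq_integral integrable_abs int AE_I2 abs_ge_zero)
    also have "(\<integral>\<omega>. \<bar>?x n \<omega>\<bar> \<partial>P) = (\<integral>\<omega>. ?x n \<omega> + 2 * max (- ?x n \<omega>) 0 \<partial>P)"
      by (intro Bochner_Integration.integral_cong) (auto simp del: abs_real_of_ereal)
    also have "\<dots> = (\<integral>\<omega>. ?x n \<omega> \<partial>P) + 2 * (\<integral>\<omega>. max (- ?x n \<omega>) 0 \<partial>P)"
      using int by simp
    also have "\<dots> \<le> K + 2 * C"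
    proof -
      \<comment> \<open>The whole space belongs to \<open>F 0\<close>, so the inequality on events
        compares the expectations at times 0 and \<open>n\<close>.\<close>
      have "(\<integral>\<omega>. indicator (space P) \<omega> * ?x n \<omega> \<partial>P) \<le> (\<integral>\<omega>. indicator (space P) \<omega> * ?x 0 \<omega> \<partial>P)"
        by (rule supermartingale_integral[OF P]) (simp_all add: trivial_F0 space_Theta[OF P])
      moreover have "(\<integral>\<omega>. indicator (space P) \<omega> * ?x j \<omega> \<partial>P) = (\<integral>\<omega>. ?x j \<omega> \<partial>P)" for j
        by (intro Bochner_Integration.integral_cong) auto
      moreover have "(\<integral>\<omega>. ?x 0 \<omega> \<partial>P) \<le> K"
        using K[OF P] integral_abs_bound[of P "?x 0"] by linarith
      moreover have "(\<integral>\<omega>. max (- ?x n \<omega>) 0 \<partial>P) \<le> C"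
        using integral_neg_part_le_L1_mean[OF supermartingale_SL_L1(1)[of n] P] C[of n] by linarith
      ultimately show ?thesis
        by simp
    qed
    finally show ?thesis
      by (simp add: ennreal_leI)
  qed
  then show ?thesis
    by blast
qed

theorem supermartingale_converges_quasi_surely:
  assumes "\<And>k. L1_mean M H E \<Theta> (\<lambda>\<omega>. max (- X k \<omega>) 0) \<le> C"
  shows "\<exists>X_inf \<in> H_ext M \<Theta>.
    quasi_surely M E (\<lambda>\<omega>. (\<lambda>n. X n \<omega>) \<longlonglongrightarrow> X_inf \<omega>) \<and>
    E_ext \<Theta> (\<lambda>\<omega>. \<bar>X_inf \<omega>\<bar>) < \<infinity>"
proof -
  \<comment> \<open>The upper limit is defined at every point and without reference to a measure, so
    one variable is the limit for all \<open>P\<close>.\<close>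
  define Y where "Y = (\<lambda>\<omega>. limsup (\<lambda>n. X n \<omega>))"
  note [measurable] = supermartingale_approx(1)
  have [measurable]: "Y \<in> borel_measurable M"
    unfolding Y_def by measurable
  \<comment> \<open>Convergence becomes an equation between measurable functions, which makes the
    failure set measurable.\<close>
  have conv_iff: "(\<lambda>n. X n \<omega>) \<longlonglongrightarrow> Y \<omega> \<longleftrightarrow> liminf (\<lambda>n. X n \<omega>) = limsup (\<lambda>n. X n \<omega>)" for \<omega>
    unfolding Y_def using tendsto_iff_Liminf_eq_Limsup[of sequentially "\<lambda>n. X n \<omega>" "limsup (\<lambda>n. X n \<omega>)"] by simp
  obtain K where K: "\<And>P n. P \<in> \<Theta> \<Longrightarrow> (\<integral>\<^sup>+\<omega>. e2ennreal \<bar>X n \<omega>\<bar> \<partial>P) \<le> ennreal K"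
    using supermartingale_L1_bounded[OF assms] by blast
  have AE: "AE \<omega> in P. (\<lambda>n. X n \<omega>) \<longlonglongrightarrow> Y \<omega>" if "P \<in> \<Theta>" for P
    unfolding conv_iff using assms that by (rule supermartingale_AE_liminf_eq_limsup)
  have bound: "(\<integral>\<^sup>+\<omega>. e2ennreal \<bar>Y \<omega>\<bar> \<partial>P) \<le> ennreal K" if P: "P \<in> \<Theta>" for P
  proof -
    have [measurable]: "X n \<in> borel_measurable P" for n
      using measurable_Theta[OF P supermartingale_approx(1)] .
    \<comment> \<open>Almost sure convergence turns the integrand into a lower limit, ready for
      Fatou's lemma.\<close>
    have "(\<integral>\<^sup>+\<omega>. e2ennreal \<bar>Y \<omega>\<bar> \<partial>P) = (\<integral>\<^sup>+\<omega>. liminf (\<lambda>n. e2ennreal \<bar>X n \<omega>\<bar>) \<partial>P)"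
      using AE[OF P]
    proof (intro nn_integral_cong_AE, eventually_elim)
      case (elim \<omega>)
      then have "(\<lambda>n. e2ennreal \<bar>X n \<omega>\<bar>) \<longlonglongrightarrow> e2ennreal \<bar>Y \<omega>\<bar>"
        by (intro tendsto_intros)
      then show ?case
        by (intro lim_imp_Liminf[symmetric]) auto
    qed
    also have "\<dots> \<le> liminf (\<lambda>n. \<integral>\<^sup>+\<omega>. e2ennreal \<bar>X n \<omega>\<bar> \<partial>P)"
      by (rule nn_integral_liminf) measurable
    also have "\<dots> \<le> limsup (\<lambda>n. \<integral>\<^sup>+\<omega>. e2ennreal \<bar>X n \<omega>\<bar> \<partial>P)"
      by (rule Liminf_le_Limsup) simp
    also have "\<dots> \<le> ennreal K"
      using K[OF P] by (intro Limsup_bounded always_eventually) auto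
    finally show ?thesis .
  qed
  \<comment> \<open>\<open>H_ext\<close> asks for a finite minimum of two integrals, so finiteness
    for the positive part is enough.\<close>
  have "(\<integral>\<^sup>+\<omega>. e2ennreal (Y \<omega>) \<partial>P) < \<infinity>" if "P \<in> \<Theta>" for P
  proof -
    have "Y \<omega> \<le> \<bar>Y \<omega>\<bar>" for \<omega>
      by (cases "Y \<omega>") auto
    then have "(\<integral>\<^sup>+\<omega>. e2ennreal (Y \<omega>) \<partial>P) \<le> (\<integral>\<^sup>+\<omega>. e2ennreal \<bar>Y \<omega>\<bar> \<partial>P)"
      by (intro nn_integral_mono e2ennreal_mono)
    then show ?thesis
      using bound[OF that] by (auto simp: less_top[symmetric] top_unique)
  qed
  then have "Y \<in> H_ext M \<Theta>"
    unfolding H_ext_def by (auto simp: min_less_iff_disj)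
  moreover have "quasi_surely M E (\<lambda>\<omega>. (\<lambda>n. X n \<omega>) \<longlonglongrightarrow> Y \<omega>)"
  proof (rule quasi_surelyI)
    show "{\<omega>\<in>space M. \<not> (\<lambda>n. X n \<omega>) \<longlonglongrightarrow> Y \<omega>} \<in> sets M"
      unfolding conv_iff by measurable
  qed (rule AE)
  moreover have "E_ext \<Theta> (\<lambda>\<omega>. \<bar>Y \<omega>\<bar>) \<le> enn2ereal (ennreal K)"
    unfolding E_ext_def ext_expectation_abs using bound
    by (intro SUP_least) (simp add: less_eq_ennreal.rep_eq)
  \<comment> \<open>The sign of \<open>K\<close> is not known; \<open>ennreal\<close> sends a
    negative value to 0.\<close>
  moreover have "enn2ereal (ennreal K) < \<infinity>"
    by (cases "0 \<le> K") (simp_all add: enn2ereal_ennreal ennreal_neg zero_ennreal.rep_eq)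
  ultimately show ?thesis
    by (meson le_less_trans)
qed

end

end

theorem corollary4p4p1:
  fixes M :: "'a measure" and F :: "nat \<Rightarrow> 'a measure"
    and H :: "('a \<Rightarrow> real) set" and E :: "nat \<Rightarrow> ('a \<Rightarrow> real) \<Rightarrow> 'a \<Rightarrow> real"
    and \<Theta> :: "'a measure set" and X :: "nat \<Rightarrow> 'a \<Rightarrow> ereal"
  assumes "SL_expectation M F H E"
    and "SL_representation M H E \<Theta>"
    and "SL_supermartingale M F H E \<Theta> X"
    and "(SUP k. ereal (L1_mean M H E \<Theta> (\<lambda>\<omega>. max (- X k \<omega>) 0))) < \<infinity>"
  shows "\<exists>X_inf \<in> H_ext M \<Theta>.
    quasi_surely M E (\<lambda>\<omega>. (\<lambda>n. X n \<omega>) \<longlonglongrightarrow> X_inf \<omega>) \<and>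
    E_ext \<Theta> (\<lambda>\<omega>. \<bar>X_inf \<omega>\<bar>) < \<infinity>"
proof -
  interpret represented_SL_expectation M F H E \<Theta>
    using assms(1,2) by (simp add: represented_SL_expectation_def represented_SL_expectation_axioms_def)
  \<comment> \<open>A real number strictly between the supremum and infinity serves as the common
    bound, even if the supremum is not itself known to be real.\<close>
  obtain C where "(SUP k. ereal (L1_mean M H E \<Theta> (\<lambda>\<omega>. max (- X k \<omega>) 0))) \<le> ereal C"
    using assms(4) ereal_dense2 less_imp_le by blast
  then have "L1_mean M H E \<Theta> (\<lambda>\<omega>. max (- X k \<omega>) 0) \<le> C" for k
    by (simp add: SUP_le_iff)
  from supermartingale_converges_quasi_surely[OF assms(3) this] show ?thesis .
qed

end
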